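(* Let $n,p$ be positive coprime integers. If $\omega,\omega'\in\widetilde{\mathfrak S}_n$ are dominant $p$-stable affine permutations with $t^p_{i,j}(\omega)=t^p_{i,j}(\omega')$ for all $i,j\in[n]$ with $i<j$, then $\omega=\omega'$. That is, each dominant $p$-stable affine permutation is determined uniquely by its rational Shi tableau.
   Context: The affine symmetric group $\widetilde{\mathfrak S}_n$ is the group of bijections $\omega:\mathbb Z\to\mathbb Z$ with $\omega(i+n)=\omega(i)+n$ for all $i$ and $\omega(1)+\dots+\omega(n)=n(n+1)/2$. An affine permutation $\omega$ is dominant if $\omega^{-1}(1)<\omega^{-1}(2)<\dots<\omega^{-1}(n)$ (equivalently $\omega^{-1}$ is the minimal length representative of its coset modulo the symmetric group $\mathfrak S_n$). It is $p$-stable if $\omega(i)<\omega(i+p)$ for all $i\in\mathbb Z$. For $i<j$ in $[n]$ set $k_{i,j}(\omega)=\left|\left\lfloor \frac{\omega^{-1}(j)-\omega^{-1}(i)}{n}\right\rfloor\right|$. Let $s\in\mathfrak S_n$ be the permutation with $s(i)\in[n]$ and $s(i)\equiv\omega^{-1}(i)\pmod n$ for $i\in[n]$. For $n\ge2$ write $p=mn+r$ with $m\ge0$ and $r\in[n-1]$. The rational Shi tableau of a dominant $p$-stable $\omega$ is the collection of numbers, for $i<j$ in $[n]$: $t^p_{i,j}(\omega)=\min(k_{i,j}(\omega),m)$ if $r+s(i)<s(j)$ or $s(i)+r-n<s(j)<s(i)$, and $t^p_{i,j}(\omega)=\min(k_{i,j}(\omega),m+1)$ otherwise. (For $n=1$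 the tableau is empty.) *)

theory Defs
  imports "HOL-Number_Theory.Cong"
begin

definition affine_symmetric_group :: "nat \<Rightarrow> (int \<Rightarrow> int) set" where
  "affine_symmetric_group n =
     {\<omega>. bij \<omega> \<and> (\<forall>i. \<omega> (i + int n) = \<omega> i + int n) \<and>
          (\<Sum>i = 1..int n. \<omega> i) = int n * (int n + 1) div 2}"

definition dominant :: "nat \<Rightarrow> (int \<Rightarrow> int) \<Rightarrow> bool" where
  "dominant n \<omega> \<longleftrightarrow> strict_mono_on {1..int n} (inv \<omega>)"

definition p_stable :: "nat \<Rightarrow> (int \<Rightarrow> int) \<Rightarrow> bool" where
  "p_stable p \<omega> \<longleftrightarrow> (\<forall>i. \<omega> i < \<omega> (i + int p))"

definition shi_k :: "nat \<Rightarrow> (int \<Rightarrow> int) \<Rightarrow> int \<Rightarrow> int \<Rightarrow> int" where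
  "shi_k n \<omega> i j = \<bar>(inv \<omega> j - inv \<omega> i) div int n\<bar>"

text \<open>The representative of \<open>\<omega>\<inverse>(i)\<close> modulo \<open>n\<close> in \<open>{1..n}\<close> (so \<open>n\<close>, not \<open>0\<close>, represents the zero class).\<close>

definition residue_perm :: "nat \<Rightarrow> (int \<Rightarrow> int) \<Rightarrow> int \<Rightarrow> int" where
  "residue_perm n \<omega> i = (THE a. a \<in> {1..int n} \<and> [a = inv \<omega> i] (mod int n))"

text \<open>For \<open>n \<ge> 2\<close> and \<open>p\<close> coprime to \<open>n\<close>, the remainder \<open>p mod n\<close> lies in \<open>{1..n - 1}\<close>, so
  \<open>m = p div n\<close>, \<open>r = p mod n\<close> is the unique decomposition \<open>p = m n + r\<close> with \<open>m \<ge> 0\<close> and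
  \<open>r \<in> {1..n - 1}\<close>. Only the entries with \<open>1 \<le> i < j \<le> n\<close> belong to the tableau.\<close>

definition rational_shi_tableau :: "nat \<Rightarrow> nat \<Rightarrow> (int \<Rightarrow> int) \<Rightarrow> int \<Rightarrow> int \<Rightarrow> int" where
  "rational_shi_tableau n p \<omega> i j =
     (let m = int (p div n); r = int (p mod n); s = residue_perm n \<omega> in
      if r + s i < s j \<or> (s i + r - int n < s j \<and> s j < s i)
      then min (shi_k n \<omega> i j) m
      else min (shi_k n \<omega> i j) (m + 1))"

end

theory Submission
  imports Defs
begin

text \<open>
  Write \<open>b = \<omega>\<inverse>\<close> and let \<open>\<Delta> = {x. \<omega> x \<ge> 1}\<close>. For dominant \<open>\<omega>\<close>, stability says that \<open>\<Delta>\<close> is closed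
  under adding \<open>n\<close> and \<open>p\<close>, and the \<open>n\<close>-generators of \<open>\<Delta>\<close> are \<open>b 1 < \<dots> < b n\<close>. The tableau entry at
  \<open>(i, j)\<close> is the number of \<open>k \<ge> 1\<close> with \<open>0 < b j - b i - k n < p\<close>. Hence its row sums count the gaps
  of \<open>\<Delta>\<close> between \<open>b i\<close> and \<open>b i + p\<close>, and its column sums count the elements of \<open>\<Delta> + n\<close> between
  \<open>b j - p\<close> and \<open>b j\<close>. These numbers determine the ranks of \<open>b i\<close> and \<open>b i + p\<close> in the set \<open>S\<close> of
  \<open>(n + p)\<close>-generators of \<open>\<Delta>\<close>. The map sending \<open>x\<close> to \<open>x + p\<close> if \<open>x\<close> is some \<open>b i\<close>, and to \<open>x - n\<close>
  otherwise, permutes \<open>S\<close> in a single cycle, because \<open>S\<close> meets every residue class modulo \<open>n + p\<close>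
  once. If the tableaux of \<open>\<omega>\<close> and \<open>\<omega>'\<close> agree, then the order isomorphism between the two sets \<open>S\<close>
  commutes with these cycles, so it is a translation by a constant \<open>c\<close>, and \<open>\<omega>' (x + c) = \<omega> x\<close>. The
  normalisation of the sum over a window forces \<open>c = 0\<close>.
\<close>

section \<open>Order isomorphisms between finite sets\<close>

lemma rank_strict_mono:
  fixes h :: "'a::linorder \<Rightarrow> 'b::linorder"
  assumes "strict_mono_on X h" "x \<in> X"
  shows "card {y \<in> h ` X. y < h x} = card {z \<in> X. z < x}"
proof -
  have "{y \<in> h ` X. y < h x} = h ` {z \<in> X. z < x}"
    using assms by (auto simp: strict_mono_on_less)
  moreover have "inj_on h {z \<in> X. z < x}"
    using strict_mono_on_imp_inj_on[OF assms(1)] by (rule inj_on_subset) auto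
  ultimately show ?thesis
    by (simp add: card_image)
qed

lemma rank_inject:
  fixes Y :: "'a::linorder set"
  assumes "finite Y" "x \<in> Y" "y \<in> Y" "card {z \<in> Y. z < x} = card {z \<in> Y. z < y}"
  shows "x = y"
proof -
  have less: "card {z \<in> Y. z < u} < card {z \<in> Y. z < v}" if "u \<in> Y" "u < v" for u v
    using assms(1) that by (intro psubset_card_mono) auto
  show ?thesis
    using less[of x y] less[of y x] assms(2-4) by (cases x y rule: linorder_cases) simp_all
qed

text \<open>\<open>g x\<close> and \<open>h x\<close> have the same rank in the common image, namely
  the rank of \<open>x\<close> in \<open>X\<close>.\<close>

lemma strict_mono_on_eqI:
  fixes g h :: "'a::linorder \<Rightarrow> 'b::linorder"
  assumes "finite X" "strict_mono_on X g" "strict_mono_on X h" "g ` X = h ` X" "x \<in> X"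
  shows "g x = h x"
proof (rule rank_inject[of "h ` X"])
  show "card {z \<in> h ` X. z < g x} = card {z \<in> h ` X. z < h x}"
    using rank_strict_mono[OF assms(2,5)] rank_strict_mono[OF assms(3,5)] assms(4) by simp
qed (use assms in auto)

text \<open>The element of rank \<open>k\<close> in \<open>X\<close> goes to the entry at index
  \<open>k\<close> of the sorted list of \<open>Y\<close>.\<close>

lemma ex_strict_mono_on_finite:
  fixes X :: "'a::linorder set" and Y :: "'b::linorder set"
  assumes "finite X" "finite Y" "card X = card Y"
  shows "\<exists>h. strict_mono_on X h \<and> h ` X = Y"
proof -
  define rk where "rk x = card {z \<in> X. z < x}" for x
  have rk_less: "rk x < rk y" if "x \<in> X" "x < y" for x y
    unfolding rk_def using assms(1) that by (intro psubset_card_mono) auto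
  have rk_lt: "rk x < card Y" if "x \<in> X" for x
    unfolding rk_def assms(3)[symmetric] using assms(1) that by (intro psubset_card_mono) auto
  define h where "h x = sorted_list_of_set Y ! rk x" for x
  have mono: "strict_mono_on X h"
  proof (rule strict_mono_onI)
    fix x y assume "x \<in> X" "y \<in> X" "x < y"
    then show "h x < h y"
      unfolding h_def
      using rk_less[of x y] rk_lt[of y] strict_sorted_list_of_set[of Y]
      by (auto simp: sorted_wrt_iff_nth_less)
  qed
  moreover have "h ` X = Y"
  proof (rule card_subset_eq[OF assms(2)])
    show "h ` X \<subseteq> Y"
    proof (rule image_subsetI)
      fix x assume "x \<in> X"
      then have "h x \<in> set (sorted_list_of_set Y)"
        unfolding h_def using rk_lt by (intro nth_mem) simp
      then show "h x \<in> Y"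
        using assms(2) by simp
    qed
    show "card (h ` X) = card Y"
      using strict_mono_on_imp_inj_on[OF mono] assms(3) by (simp add: card_image)
  qed
  ultimately show ?thesis
    by blast
qed

section \<open>Generators of a set of integers closed under a translation\<close>

text \<open>If \<open>D\<close> is closed under adding \<open>q\<close>, these are the elements of
  \<open>D\<close> that are least in their residue class modulo \<open>q\<close>.\<close>

definition generators :: "int \<Rightarrow> int set \<Rightarrow> int set" where
  "generators q D = {x \<in> D. x - q \<notin> D}"

locale shift_closed =
  fixes q :: int and D :: "int set" and L M :: int
  assumes q_pos: "q > 0"
    and closed: "x \<in> D \<Longrightarrow> x + q \<in> D"
    and lower: "x \<in> D \<Longrightarrow> L \<le> x"
    and upper: "M \<le> x \<Longrightarrow> x \<in> D"
begin

lemma finite_generators: "finite (generators q D)"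
proof (rule finite_subset)
  show "generators q D \<subseteq> {L..<M + q}"
  proof
    fix x assume "x \<in> generators q D"
    then show "x \<in> {L..<M + q}"
      using lower[of x] upper[of "x - q"] by (force simp: generators_def)
  qed
qed simp

text \<open>Moving the window one step right drops \<open>y - q\<close> and takes in
  \<open>y\<close>. As \<open>y - q \<in> D\<close> implies \<open>y \<in> D\<close>, the count
  grows, by one, exactly when \<open>y\<close> is a generator. For \<open>y \<le> L\<close> both
  sides vanish.\<close>

lemma card_generators_less:
  "card {x \<in> generators q D. x < y} = card (D \<inter> {y - q..<y})"
proof -
  have below: "card {x \<in> generators q D. x < z} = card (D \<inter> {z - q..<z})" if "z \<le> L" for z
  proof -
    have "{x \<in> generators q D. x < z} = {}" "D \<inter> {z - q..<z} = {}"
      using lower that by (fastforce simp: generators_def)+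
    then show ?thesis
      by (simp only:)
  qed
  show ?thesis
  proof (cases "y \<le> L")
    case False
    then have "L \<le> y" by simp
    then show ?thesis
    proof (induction y rule: int_ge_induct)
      case base
      show ?case using below by blast
    next
      case (step y)
      have fin: "finite {x \<in> generators q D. x < y}"
        using finite_generators by simp
      have split: "{x \<in> generators q D. x < y + 1} =
          {x \<in> generators q D. x < y} \<union> (generators q D \<inter> {y})"
        by auto
      have win1: "D \<inter> {y - q..<y} = (D \<inter> {y - q}) \<union> (D \<inter> {y - q<..<y})"
        using q_pos by auto
      have win2: "D \<inter> {y + 1 - q..<y + 1} = (D \<inter> {y}) \<union> (D \<inter> {y - q<..<y})"
        using q_pos by auto
      have "card {x \<in> generators q D. x < y + 1}
          = card {x \<in> generators q D. x < y} + card (generators q D \<inter> {y})"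
        unfolding split using fin by (subst card_Un_disjoint) auto
      moreover have "card (D \<inter> {y - q..<y}) = card (D \<inter> {y - q}) + card (D \<inter> {y - q<..<y})"
        unfolding win1 by (subst card_Un_disjoint) auto
      moreover have "card (D \<inter> {y + 1 - q..<y + 1}) = card (D \<inter> {y}) + card (D \<inter> {y - q<..<y})"
        unfolding win2 by (subst card_Un_disjoint) auto
      moreover have "card (D \<inter> {y}) = card (D \<inter> {y - q}) + card (generators q D \<inter> {y})"
        using closed[of "y - q"] by (auto simp: generators_def Int_insert_right)
      ultimately show ?case
        using step.IH by linarith
    qed
  qed (use below in blast)
qed

text \<open>All generators lie below \<open>M + q\<close>, and the window of length \<open>q\<close>
  ending there is contained in \<open>D\<close>.\<close>

lemma card_generators: "card (generators q D) = nat q"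
proof -
  have "x < M + q" if "x \<in> generators q D" for x
    using upper[of "x - q"] that by (force simp: generators_def)
  then have "{x \<in> generators q D. x < M + q} = generators q D"
    by auto
  then have "card (generators q D) = card (D \<inter> {M..<M + q})"
    using card_generators_less[of "M + q"] by simp
  also have "D \<inter> {M..<M + q} = {M..<M + q}"
    using upper by auto
  finally show ?thesis
    by simp
qed

lemma closed_mult: "x \<in> D \<Longrightarrow> x + int k * q \<in> D"
proof (induction k)
  case (Suc k)
  then show ?case
    using closed[of "x + int k * q"] by (simp add: algebra_simps)
qed simp

lemma generators_cong_eq:
  assumes "x \<in> generators q D" "y \<in> generators q D" "[x = y] (mod q)"
  shows "x = y"
proof -
  have not_less: "\<not> u < v" if "u \<in> D" "v \<in> generators q D" "[u = v] (mod q)" for u v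
  proof
    assume "u < v"
    from that(3) have "q dvd v - u"
      by (metis cong_iff_dvd_diff cong_sym)
    then obtain l where l: "v - u = q * l"
      by blast
    with \<open>u < v\<close> q_pos have "l \<ge> 1"
      by (metis diff_gt_0_iff_gt int_one_le_iff_zero_less zero_less_mult_pos)
    \<comment> \<open>One step fewer than from \<open>u\<close> to \<open>v\<close>, so
      \<open>v - q\<close> is still reached from \<open>u\<close> inside \<open>D\<close>.\<close>
    then have "v - q = u + int (nat (l - 1)) * q"
      using l by (simp add: algebra_simps)
    then have "v - q \<in> D"
      using closed_mult[OF that(1)] by metis
    then show False
      using that(2) by (simp add: generators_def)
  qed
  show ?thesis
    using not_less[of x y] not_less[of y x] assms by (auto simp: generators_def cong_sym)
qed

end

section \<open>Dominant stable affine permutations\<close>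

text \<open>Each unit shift of the window replaces \<open>f (1 + c)\<close> by
  \<open>f (int n + 1 + c)\<close>, a gain of \<open>int n\<close>.\<close>

lemma sum_affine_window:
  fixes f :: "int \<Rightarrow> int"
  assumes "\<And>x. f (x + int n) = f x + int n"
  shows "(\<Sum>i = 1..int n. f (i + c)) = (\<Sum>i = 1..int n. f i) + int n * c"
proof -
  have step: "(\<Sum>i = 1..int n. f (i + (c + 1))) = (\<Sum>i = 1..int n. f (i + c)) + int n" for c
  proof -
    have "(\<Sum>i = 1..int n. f (i + (c + 1))) = (\<Sum>i = 2..int n + 1. f (i + c))"
      by (rule sum.reindex_bij_witness[of _ "\<lambda>i. i - 1" "\<lambda>i. i + 1"]) (auto simp: algebra_simps)
    moreover have "(\<Sum>i = 1..int n + 1. f (i + c)) = f (1 + c) + (\<Sum>i = 2..int n + 1. f (i + c))"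
    proof -
      have "{1..int n + 1} = insert 1 {2..int n + 1}" by auto
      then show ?thesis by simp
    qed
    moreover have "(\<Sum>i = 1..int n + 1. f (i + c)) = f (int n + 1 + c) + (\<Sum>i = 1..int n. f (i + c))"
    proof -
      have "{1..int n + 1} = insert (int n + 1) {1..int n}" by auto
      then show ?thesis by simp
    qed
    moreover have "f (int n + 1 + c) = f (1 + c) + int n"
      using assms[of "1 + c"] by (simp add: algebra_simps)
    ultimately show ?thesis by linarith
  qed
  show ?thesis
  proof (induction c rule: int_induct[of _ 0])
    case (step1 i)
    then show ?case using step[of i] by (simp add: algebra_simps)
  next
    case (step2 i)
    then show ?case using step[of "i - 1"] by (simp add: algebra_simps)
  qed simp
qed

locale dominant_stable =
  fixes n p :: nat and \<omega> :: "int \<Rightarrow> int"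
  assumes n_pos: "n > 0" and p_pos: "p > 0" and coprime: "coprime n p"
    and affine: "\<omega> \<in> affine_symmetric_group n"
    and dominant: "dominant n \<omega>" and stable: "p_stable p \<omega>"
begin

abbreviation "b \<equiv> inv \<omega>"

definition "\<Delta> = {x. \<omega> x \<ge> 1}"

definition "S = generators (int n + int p) \<Delta>"

definition "A = b ` {1..int n}"

lemma bij: "bij \<omega>" and periodic: "\<omega> (x + int n) = \<omega> x + int n"
  and sum_window: "(\<Sum>i = 1..int n. \<omega> i) = int n * (int n + 1) div 2"
  using affine by (auto simp: affine_symmetric_group_def)

lemma w_b [simp]: "\<omega> (b x) = x"
  using bij by (simp add: bij_is_surj surj_f_inv_f)

lemma b_w [simp]: "b (\<omega> x) = x"
  using bij by (simp add: bij_is_inj)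

lemma w_inject: "\<omega> x = \<omega> y \<longleftrightarrow> x = y"
  using bij by (metis b_w)

lemma periodic_mult: "\<omega> (x + k * int n) = \<omega> x + k * int n"
proof (induction k rule: int_induct[of _ 0])
  case (step1 i)
  then show ?case using periodic[of "x + i * int n"] by (simp add: algebra_simps)
next
  case (step2 i)
  then show ?case using periodic[of "x + (i - 1) * int n"] by (simp add: algebra_simps)
qed simp

lemma b_less: "b i < b j" if "i < j" "1 \<le> i" "j \<le> int n"
  using dominant that by (auto simp: dominant_def strict_mono_on_def)

lemma w_b_minus: "\<omega> (b j - k * int n) = j - k * int n"
  using periodic_mult[of "b j" "- k"] by simp

lemma w_b_plus: "\<omega> (b j + k * int n) = j + k * int n"
  using periodic_mult[of "b j" k] by simp

lemma stable_less: "\<omega> x < \<omega> (x + int p)"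
  using stable by (auto simp: p_stable_def)

text \<open>The displacement \<open>\<omega> x - x\<close> is periodic modulo \<open>n\<close>, so
  its maximum over one period bounds it everywhere.\<close>

lemma displacement_bounded: "\<exists>C. \<forall>x. \<bar>\<omega> x - x\<bar> \<le> C"
proof -
  define C where "C = Max ((\<lambda>x. \<bar>\<omega> x - x\<bar>) ` {0..<int n})"
  have "\<bar>\<omega> x - x\<bar> \<le> C" for x
  proof -
    define u where "u = x mod int n"
    have x: "x = u + (x div int n) * int n"
      by (simp add: u_def)
    have "u \<in> {0..<int n}"
      using n_pos by (simp add: u_def)
    then have "\<bar>\<omega> u - u\<bar> \<le> C"
      unfolding C_def by (intro Max_ge) auto
    moreover have "\<omega> x - x = \<omega> u - u"
      using periodic_mult[of u "x div int n"] x by simp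
    ultimately show ?thesis
      by simp
  qed
  then show ?thesis by blast
qed

section \<open>The set \<open>\<Delta>\<close> and its generators\<close>

lemma \<Delta>_closed_n: "x \<in> \<Delta> \<Longrightarrow> x + int n \<in> \<Delta>"
  by (simp add: \<Delta>_def periodic)

lemma \<Delta>_closed_p: "x \<in> \<Delta> \<Longrightarrow> x + int p \<in> \<Delta>"
  using stable_less[of x] by (simp add: \<Delta>_def)

lemma shift_closed_\<Delta>:
  obtains L M where "shift_closed (int n) \<Delta> L M" "shift_closed (int n + int p) \<Delta> L M"
proof -
  obtain C where C: "\<And>x. \<bar>\<omega> x - x\<bar> \<le> C"
    using displacement_bounded by blast
  have low: "1 - C \<le> x" if "x \<in> \<Delta>" for x
    using C[of x] that by (auto simp: \<Delta>_def)
  have up: "x \<in> \<Delta>" if "1 + C \<le> x" for x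
    using C[of x] that by (auto simp: \<Delta>_def)
  have "x + (int n + int p) \<in> \<Delta>" if "x \<in> \<Delta>" for x
    using \<Delta>_closed_p[OF \<Delta>_closed_n[OF that]] by (simp add: algebra_simps)
  then show ?thesis
    using n_pos low up \<Delta>_closed_n
    by (intro that[of "1 - C" "1 + C"]) (unfold_locales; auto)+
qed

lemma generators_n: "generators (int n) \<Delta> = A"
proof -
  have "x \<in> generators (int n) \<Delta> \<longleftrightarrow> \<omega> x \<in> {1..int n}" for x
    using periodic_mult[of x "-1"] by (auto simp: generators_def \<Delta>_def)
  moreover have "x \<in> A \<longleftrightarrow> \<omega> x \<in> {1..int n}" for x
    unfolding A_def by (metis (no_types, lifting) b_w imageE imageI w_b)
  ultimately show ?thesis
    by blast
qed

lemma finite_S: "finite S" and card_S: "card S = n + p"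
  and rank_S: "card {x \<in> S. x < y} = card (\<Delta> \<inter> {y - (int n + int p)..<y})"
  and S_cong_eq: "x \<in> S \<Longrightarrow> z \<in> S \<Longrightarrow> [x = z] (mod (int n + int p)) \<Longrightarrow> x = z"
proof -
  obtain L M where "shift_closed (int n + int p) \<Delta> L M"
    using shift_closed_\<Delta> by blast
  then interpret shift_closed "int n + int p" \<Delta> L M .
  show "finite S" "card S = n + p"
    "card {x \<in> S. x < y} = card (\<Delta> \<inter> {y - (int n + int p)..<y})"
    "x \<in> S \<Longrightarrow> z \<in> S \<Longrightarrow> [x = z] (mod (int n + int p)) \<Longrightarrow> x = z"
    unfolding S_def
    using finite_generators card_generators card_generators_less generators_cong_eq by auto
qed

lemma A_subset_S: "A \<subseteq> S"
  unfolding generators_n[symmetric] S_def generators_def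
proof (rule subsetI, clarify)
  fix x assume x: "x \<in> \<Delta>" "x - int n \<notin> \<Delta>" and "x - (int n + int p) \<in> \<Delta>"
  then show False
    using \<Delta>_closed_p[of "x - (int n + int p)"] by simp
qed

lemma A_plus_p_subset_S: "x \<in> A \<Longrightarrow> x + int p \<in> S"
  unfolding generators_n[symmetric] S_def generators_def
  using \<Delta>_closed_p by (auto simp: algebra_simps)

text \<open>Membership on the left means \<open>x - n \<in> \<Delta>\<close> and
  \<open>x - n - p \<notin> \<Delta>\<close>; membership of \<open>y\<close> on the right means
  \<open>y \<in> \<Delta>\<close> and \<open>y - p \<notin> \<Delta>\<close>. Hence subtracting
  \<open>n\<close> is a bijection from \<open>S - A\<close> onto \<open>S\<close> without
  \<open>A + p\<close>.\<close>

lemma S_minus_A_iff: "x \<in> S - A \<longleftrightarrow> x - int n \<in> S - (\<lambda>a. a + int p) ` A"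
proof -
  have 1: "x \<in> S - A \<longleftrightarrow> x - int n \<in> \<Delta> \<and> x - int n - int p \<notin> \<Delta>"
    unfolding generators_n[symmetric] S_def generators_def
    using \<Delta>_closed_n[of "x - int n"] by (auto simp: diff_diff_eq)
  have 2: "y \<in> S - (\<lambda>a. a + int p) ` A \<longleftrightarrow> y \<in> \<Delta> \<and> y - int p \<notin> \<Delta>" for y
  proof -
    have "y \<in> (\<lambda>a. a + int p) ` A \<longleftrightarrow> y - int p \<in> A"
      by (auto intro: rev_image_eqI[of "y - int p"])
    then show ?thesis
      unfolding generators_n[symmetric] S_def generators_def
      using \<Delta>_closed_p[of "y - int p"] \<Delta>_closed_n[of "y - int n - int p"]
      by (auto simp: algebra_simps)
  qed
  show ?thesis
    unfolding 1 2 by simp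
qed

lemma card_window_n:
  assumes "i \<in> {1..int n}"
  shows "card (\<Delta> \<inter> {b i - int n..<b i}) = nat (i - 1)"
proof -
  obtain L M where "shift_closed (int n) \<Delta> L M"
    using shift_closed_\<Delta> by blast
  then interpret shift_closed "int n" \<Delta> L M .
  have mono: "strict_mono_on {1..int n} b"
    using dominant by (simp add: dominant_def)
  have "card (\<Delta> \<inter> {b i - int n..<b i}) = card {x \<in> b ` {1..int n}. x < b i}"
    using card_generators_less[of "b i"] by (simp add: generators_n A_def)
  also have "\<dots> = card {j \<in> {1..int n}. j < i}"
    using rank_strict_mono[OF mono assms] .
  also have "{j \<in> {1..int n}. j < i} = {1..<i}"
    using assms by auto
  finally show ?thesis by simp
qed

subsection \<open>The tableau\<close>

abbreviation "T \<equiv> rational_shi_tableau n p \<omega>"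

text \<open>Two readings of one condition: \<open>b j - k n\<close> lies strictly between
  \<open>b i\<close> and \<open>b i + p\<close>, or \<open>b i + k n\<close> lies strictly between
  \<open>b j - p\<close> and \<open>b j\<close>. The first serves the row sums, the second the
  column sums.\<close>

definition "K i j = {k. 1 \<le> k \<and> 0 < b j - b i - k * int n \<and> b j - b i - k * int n < int p}"

lemma residue_perm_eq: "residue_perm n \<omega> i = (b i - 1) mod int n + 1"
  unfolding residue_perm_def
proof (rule the_equality)
  show "(b i - 1) mod int n + 1 \<in> {1..int n} \<and> [(b i - 1) mod int n + 1 = b i] (mod int n)"
    using n_pos by (auto simp: cong_def mod_add_left_eq add1_zle_eq)
next
  fix a assume a: "a \<in> {1..int n} \<and> [a = b i] (mod int n)"
  then have "[a - 1 = b i - 1] (mod int n)"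
    by (simp add: cong_diff)
  with a show "a = (b i - 1) mod int n + 1"
    by (auto simp: cong_def)
qed

text \<open>With \<open>b j - b i = q N + \<rho>\<close>, the set \<open>K i j\<close> is an integer
  interval ending at \<open>q\<close>, of size \<open>min q (m + 1)\<close> if
  \<open>\<rho> < r\<close> and \<open>min q m\<close> otherwise. The case condition of the tableau
  is \<open>r < \<rho>\<close>, so only \<open>\<rho> = r\<close> needs a separate argument.\<close>

lemma card_K:
  assumes "1 \<le> i" "i < j" "j \<le> int n"
  shows "finite (K i j)" and "int (card (K i j)) = T i j"
proof -
  define N where "N = int n"
  define d where "d = b j - b i"
  define q where "q = d div N"
  define \<rho> where "\<rho> = d mod N"
  define m where "m = int (p div n)"
  define r where "r = int (p mod n)"
  define si where "si = residue_perm n \<omega> i"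
  define sj where "sj = residue_perm n \<omega> j"
  have N: "N > 0" using n_pos by (simp add: N_def)
  have d: "d = q * N + \<rho>" by (simp add: q_def \<rho>_def)
  have p: "int p = m * N + r"
    unfolding m_def r_def N_def by (metis div_mult_mod_eq of_nat_add of_nat_mult)
  have r: "0 \<le> r" "r < N" using n_pos by (simp_all add: r_def N_def)
  have m: "0 \<le> m" by (simp add: m_def)
  have d_pos: "d > 0" using b_less assms by (simp add: d_def)
  then have q: "q \<ge> 0" using N by (simp add: q_def pos_imp_zdiv_nonneg_iff)
  \<comment> \<open>Otherwise \<open>i\<close> and \<open>j\<close> would be congruent modulo
    \<open>n\<close>, although \<open>0 < j - i < n\<close>.\<close>
  have "\<rho> \<noteq> 0"
  proof
    assume "\<rho> = 0"
    then have "b j = b i + q * int n" using d by (simp add: d_def N_def)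
    then have "j = i + q * N" using w_b_plus[of i q] w_b[of j] by (simp add: N_def)
    then have "0 < q * N" "q * N < N" using assms unfolding N_def by linarith+
    moreover from this have "1 * N \<le> q * N"
      using N by (intro mult_right_mono) (auto simp: zero_less_mult_iff)
    ultimately show False by simp
  qed
  then have \<rho>: "0 < \<rho>" "\<rho> < N"
    using N pos_mod_sign[of N d] pos_mod_bound[of N d] unfolding \<rho>_def by linarith+
  \<comment> \<open>In the boundary case stability makes the two minima agree: if
    \<open>q > m\<close>, then \<open>\<omega>\<close> at \<open>b i + p\<close> is at most
    \<open>j - n \<le> 0\<close>, below its value \<open>i\<close> at \<open>b i\<close>.\<close>
  have q_le: "q \<le> m" if "\<rho> = r"
  proof (rule ccontr)
    assume "\<not> q \<le> m"
    then have "N \<le> (q - m) * N" using N mult_right_mono[of 1 "q - m" N] by simp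
    moreover have "b i + int p = b j - (q - m) * int n"
      using d p that by (simp add: d_def N_def algebra_simps)
    then have "\<omega> (b i + int p) = j - (q - m) * N"
      using w_b_minus by (simp add: N_def)
    ultimately show False
      using stable_less[of "b i"] w_b[of i] assms unfolding N_def by linarith
  qed
  have si: "1 \<le> si" "si \<le> N" and sj: "1 \<le> sj" "sj \<le> N"
    using N by (simp_all add: si_def sj_def residue_perm_eq N_def add1_zle_eq)
  have "\<rho> = (sj - si) mod N"
    unfolding \<rho>_def d_def si_def sj_def residue_perm_eq N_def by (simp add: mod_diff_eq)
  moreover have "(sj - si) mod N = (if si \<le> sj then sj - si else sj - si + N)"
  proof (cases "si \<le> sj")
    case True
    then show ?thesis using si sj by simp
  next
    case False
    have "(sj - si) mod N = (sj - si + N) mod N" by simp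
    also have "\<dots> = sj - si + N" using False si sj by (intro mod_pos_pos_trivial) auto
    finally show ?thesis using False by simp
  qed
  ultimately have "r + si < sj \<or> (si + r - N < sj \<and> sj < si) \<longleftrightarrow> r < \<rho>"
    using r by auto
  then have T: "T i j = (if r < \<rho> then min q m else min q (m + 1))"
    using q by (simp add: rational_shi_tableau_def shi_k_def Let_def flip: m_def r_def si_def sj_def N_def d_def q_def)
  have pos: "0 < d - k * N \<longleftrightarrow> k \<le> q" for k
  proof
    assume "0 < d - k * N"
    then have "0 < (q - k + 1) * N" using d \<rho> by (simp add: algebra_simps)
    then show "k \<le> q" using N by (simp add: zero_less_mult_iff)
  next
    assume "k \<le> q"
    then have "k * N \<le> q * N" using N by simp
    then show "0 < d - k * N" using d \<rho> by linarith
  qed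
  have lt: "d - k * N < int p \<longleftrightarrow> (if \<rho> < r then q - k \<le> m else q - k < m)" for k
  proof -
    have e: "d - k * N < int p \<longleftrightarrow> (q - k - m) * N < r - \<rho>"
      using d p by (simp add: algebra_simps)
    \<comment> \<open>Since \<open>- N < r - \<rho> < N\<close>, a nonzero multiple of
      \<open>N\<close> compares with \<open>r - \<rho>\<close> by its sign alone; only
      \<open>q - k = m\<close> depends on \<open>\<rho>\<close>.\<close>
    show ?thesis
    proof (cases "q - k - m" "0::int" rule: linorder_cases)
      case less
      then have "(q - k - m) * N \<le> - N"
        using N mult_right_mono[of "q - k - m" "-1" N] by simp
      then have "d - k * N < int p" unfolding e using r \<rho> by linarith
      then show ?thesis using less by simp
    next
      case equal
      then show ?thesis using e by auto
    next
      case greater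
      then have "N \<le> (q - k - m) * N"
        using N mult_right_mono[of 1 "q - k - m" N] by simp
      then have "\<not> d - k * N < int p" unfolding e using r \<rho> by linarith
      then show ?thesis using greater by simp
    qed
  qed
  have K: "K i j = (if \<rho> < r then {max 1 (q - m)..q} else {max 1 (q - m + 1)..q})"
    unfolding K_def d_def[symmetric] N_def[symmetric] pos lt by auto
  show "finite (K i j)"
    by (simp add: K)
  show "int (card (K i j)) = T i j"
    using q m q_le unfolding K T by auto
qed

section \<open>Row and column sums of the tableau\<close>

text \<open>A gap \<open>y\<close> of \<open>\<Delta>\<close> is uniquely \<open>b j - k n\<close>
  with \<open>j\<close> in \<open>{1..n}\<close> and \<open>k \<ge> 1\<close>; if it lies above
  \<open>b i\<close>, then \<open>b j > b i\<close> and so \<open>j > i\<close>.\<close>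

lemma row_sum:
  assumes "i \<in> {1..int n}"
  shows "int (card ({b i..<b i + int p} - \<Delta>)) = (\<Sum>j \<in> {i<..int n}. T i j)"
proof -
  have "bij_betw (\<lambda>(j, k). b j - k * int n) (SIGMA j:{i<..int n}. K i j) ({b i..<b i + int p} - \<Delta>)"
  proof (rule bij_betw_imageI)
    show "inj_on (\<lambda>(j, k). b j - k * int n) (SIGMA j:{i<..int n}. K i j)"
    proof (rule inj_onI, clarify)
      fix j k j' k'
      assume j: "j \<in> {i<..int n}" and j': "j' \<in> {i<..int n}"
        and "b j - k * int n = b j' - k' * int n"
      then have eq: "j - k * int n = j' - k' * int n"
        using w_b_minus by metis
      then have "j - 1 = (j' - 1) + (k - k') * int n"
        by (simp add: algebra_simps)
      then have "(j - 1) mod int n = (j' - 1) mod int n"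
        by (simp only: mod_mult_self1)
      moreover have "(j - 1) mod int n = j - 1" "(j' - 1) mod int n = j' - 1"
        using j j' assms by auto
      ultimately have "j = j'" by simp
      then show "j = j' \<and> k = k'" using eq n_pos by simp
    qed
  next
    show "(\<lambda>(j, k). b j - k * int n) ` (SIGMA j:{i<..int n}. K i j) = {b i..<b i + int p} - \<Delta>"
    proof (intro equalityI subsetI)
      fix y assume "y \<in> (\<lambda>(j, k). b j - k * int n) ` (SIGMA j:{i<..int n}. K i j)"
      then obtain j k where j: "j \<in> {i<..int n}" and k: "k \<in> K i j" and y: "y = b j - k * int n"
        by auto
      have "1 * int n \<le> k * int n" using k by (intro mult_right_mono) (auto simp: K_def)
      then show "y \<in> {b i..<b i + int p} - \<Delta>"
        using j k unfolding y by (auto simp: K_def \<Delta>_def w_b_minus)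
    next
      fix y assume y: "y \<in> {b i..<b i + int p} - \<Delta>"
      define j where "j = (\<omega> y - 1) mod int n + 1"
      define k where "k = - ((\<omega> y - 1) div int n)"
      have j: "1 \<le> j" "j \<le> int n"
        using n_pos by (simp_all add: j_def add1_zle_eq)
      have wy: "\<omega> y = j - k * int n"
        by (simp add: j_def k_def)
      then have y_eq: "y = b j - k * int n"
        using w_b_minus[of j k] w_inject by metis
      have "\<omega> y - 1 < 0" using y by (auto simp: \<Delta>_def)
      then have "(\<omega> y - 1) div int n < 0" using n_pos by (simp add: div_neg_pos_less0)
      then have k: "1 \<le> k" by (simp add: k_def)
      \<comment> \<open>The left endpoint is in \<open>\<Delta>\<close>, so the half-open window
        yields the strict inequality of \<open>K\<close>.\<close>
      have "y \<noteq> b i" using y assms by (auto simp: \<Delta>_def)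
      with y have yi: "b i < y" "y < b i + int p" by auto
      have "0 < k * int n" using k n_pos by simp
      then have "b i < b j" using yi y_eq by simp
      then have "i < j" using b_less[of j i] j assms by (cases i j rule: linorder_cases) auto
      then have "(j, k) \<in> (SIGMA j:{i<..int n}. K i j)"
        using j k yi y_eq by (auto simp: K_def)
      then show "y \<in> (\<lambda>(j, k). b j - k * int n) ` (SIGMA j:{i<..int n}. K i j)"
        using y_eq by force
    qed
  qed
  then have "card ({b i..<b i + int p} - \<Delta>) = card (SIGMA j:{i<..int n}. K i j)"
    by (simp add: bij_betw_same_card)
  also have "\<dots> = (\<Sum>j \<in> {i<..int n}. card (K i j))"
    using card_K(1) assms by (intro card_SigmaI) auto
  finally show ?thesis
    using card_K(2) assms by simp
qed

text \<open>An element \<open>y\<close> of \<open>\<Delta>\<close> is uniquely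
  \<open>b i + (k - 1) n\<close> with \<open>k \<ge> 1\<close>. The offset \<open>k - 1\<close>
  arises because \<open>K\<close> describes \<open>y + n\<close> rather than
  \<open>y\<close>.\<close>

lemma column_sum:
  assumes "j \<in> {1..int n}"
  shows "int (card (\<Delta> \<inter> {b j - (int n + int p)..<b j - int n})) = (\<Sum>i \<in> {1..<j}. T i j)"
proof -
  have "bij_betw (\<lambda>(i, k). b i + (k - 1) * int n) (SIGMA i:{1..<j}. K i j)
      (\<Delta> \<inter> {b j - (int n + int p)..<b j - int n})"
  proof (rule bij_betw_imageI)
    show "inj_on (\<lambda>(i, k). b i + (k - 1) * int n) (SIGMA i:{1..<j}. K i j)"
    proof (rule inj_onI, clarify)
      fix i k i' k'
      assume i: "i \<in> {1..<j}" and i': "i' \<in> {1..<j}"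
        and "b i + (k - 1) * int n = b i' + (k' - 1) * int n"
      then have eq: "i + (k - 1) * int n = i' + (k' - 1) * int n"
        using w_b_plus by metis
      then have "i mod int n = i' mod int n"
        by (metis mod_mult_self1)
      moreover have "i mod int n = i" "i' mod int n = i'"
        using i i' assms by auto
      ultimately have "i = i'" by simp
      then show "i = i' \<and> k = k'" using eq n_pos by simp
    qed
  next
    show "(\<lambda>(i, k). b i + (k - 1) * int n) ` (SIGMA i:{1..<j}. K i j)
        = \<Delta> \<inter> {b j - (int n + int p)..<b j - int n}"
    proof (intro equalityI subsetI)
      fix y assume "y \<in> (\<lambda>(i, k). b i + (k - 1) * int n) ` (SIGMA i:{1..<j}. K i j)"
      then obtain i k where i: "i \<in> {1..<j}" and k: "k \<in> K i j" and y: "y = b i + (k - 1) * int n"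
        by auto
      have "0 \<le> (k - 1) * int n" using k by (auto simp: K_def)
      then have "y \<in> \<Delta>"
        unfolding y \<Delta>_def mem_Collect_eq w_b_plus using i by simp
      then show "y \<in> \<Delta> \<inter> {b j - (int n + int p)..<b j - int n}"
        using k unfolding y by (auto simp: K_def algebra_simps)
    next
      fix y assume y: "y \<in> \<Delta> \<inter> {b j - (int n + int p)..<b j - int n}"
      define i where "i = (\<omega> y - 1) mod int n + 1"
      define k where "k = (\<omega> y - 1) div int n + 1"
      have i: "1 \<le> i" "i \<le> int n"
        using n_pos by (simp_all add: i_def add1_zle_eq)
      have wy: "\<omega> y = i + (k - 1) * int n"
        by (simp add: i_def k_def)
      then have y_eq: "y = b i + (k - 1) * int n"
        using w_b_plus[of i "k - 1"] w_inject by metis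
      have "0 \<le> \<omega> y - 1" using y by (auto simp: \<Delta>_def)
      then have k: "1 \<le> k" using n_pos by (simp add: k_def pos_imp_zdiv_nonneg_iff)
      \<comment> \<open>Stability excludes the left endpoint: it would give
        \<open>\<omega> (y + n) < j \<le> n\<close>, whereas \<open>y \<in> \<Delta>\<close> gives
        \<open>\<omega> (y + n) > n\<close>.\<close>
      have "y \<noteq> b j - (int n + int p)"
      proof
        assume "y = b j - (int n + int p)"
        then have "y + int n + int p = b j" by simp
        then have "\<omega> y + int n < j"
          using stable_less[of "y + int n"] periodic[of y] w_b[of j] by simp
        then show False using y assms by (auto simp: \<Delta>_def)
      qed
      with y have yj: "b j - (int n + int p) < y" "y < b j - int n" by auto
      have "0 \<le> (k - 1) * int n" using k by simp
      then have "b i < b j" using yj y_eq by simp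
      then have "i < j" using b_less[of j i] i assms by (cases i j rule: linorder_cases) auto
      then have "(i, k) \<in> (SIGMA i:{1..<j}. K i j)"
        using i k yj y_eq by (auto simp: K_def algebra_simps)
      then show "y \<in> (\<lambda>(i, k). b i + (k - 1) * int n) ` (SIGMA i:{1..<j}. K i j)"
        using y_eq by force
    qed
  qed
  then have "card (\<Delta> \<inter> {b j - (int n + int p)..<b j - int n}) = card (SIGMA i:{1..<j}. K i j)"
    by (simp add: bij_betw_same_card)
  also have "\<dots> = (\<Sum>i \<in> {1..<j}. card (K i j))"
    using card_K(1) assms by (intro card_SigmaI) auto
  finally show ?thesis
    using card_K(2) assms by simp
qed

section \<open>Ranks in \<open>S\<close> from the tableau\<close>

text \<open>The window of length \<open>n + p\<close> below \<open>b j\<close> is cut at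
  \<open>b j - n\<close>: the lower piece is a column sum, the upper one contains
  \<open>j - 1\<close> elements of \<open>\<Delta>\<close>.\<close>

lemma rank_b:
  assumes "j \<in> {1..int n}"
  shows "int (card {x \<in> S. x < b j}) = j - 1 + (\<Sum>i \<in> {1..<j}. T i j)"
proof -
  have "\<Delta> \<inter> {b j - (int n + int p)..<b j}
      = (\<Delta> \<inter> {b j - (int n + int p)..<b j - int n}) \<union> (\<Delta> \<inter> {b j - int n..<b j})"
    by auto
  then have "card {x \<in> S. x < b j}
      = card (\<Delta> \<inter> {b j - (int n + int p)..<b j - int n}) + card (\<Delta> \<inter> {b j - int n..<b j})"
    unfolding rank_S by (simp only:) (rule card_Un_disjoint; auto)
  then show ?thesis
    using column_sum[OF assms] card_window_n[OF assms] assms by simp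
qed

text \<open>The window is cut at \<open>b i\<close>: the lower piece contributes
  \<open>i - 1\<close>, the upper one \<open>p\<close> minus its gaps, which the row sum
  counts.\<close>

lemma rank_b_plus_p:
  assumes "i \<in> {1..int n}"
  shows "int (card {x \<in> S. x < b i + int p}) = i - 1 + int p - (\<Sum>j \<in> {i<..int n}. T i j)"
proof -
  have "\<Delta> \<inter> {b i + int p - (int n + int p)..<b i + int p}
      = (\<Delta> \<inter> {b i - int n..<b i}) \<union> (\<Delta> \<inter> {b i..<b i + int p})"
    by auto
  then have "card {x \<in> S. x < b i + int p}
      = card (\<Delta> \<inter> {b i - int n..<b i}) + card (\<Delta> \<inter> {b i..<b i + int p})"
    unfolding rank_S by (simp only:) (rule card_Un_disjoint; auto)
  moreover have "card (\<Delta> \<inter> {b i..<b i + int p}) + card ({b i..<b i + int p} - \<Delta>) = p"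
    using card_Int_Diff[of "{b i..<b i + int p}" \<Delta>] by (simp add: Int_commute)
  ultimately show ?thesis
    using row_sum[OF assms] card_window_n[OF assms] assms by simp
qed

text \<open>Both moves, by \<open>p\<close> and by \<open>- n\<close>, add \<open>p\<close> modulo
  \<open>n + p\<close>. As \<open>p\<close> is invertible there, the walk from \<open>x\<close>
  reaches every residue class, and each class contains at most one element of
  \<open>S\<close>.\<close>

lemma S_invariant_constant:
  assumes "\<And>x. x \<in> A \<Longrightarrow> \<delta> (x + int p) = \<delta> x"
    and "\<And>x. x \<in> S - A \<Longrightarrow> \<delta> (x - int n) = \<delta> x"
    and "x \<in> S" "y \<in> S"
  shows "\<delta> x = \<delta> y"
proof -
  define Q where "Q = int n + int p"
  have walk: "\<exists>z \<in> S. \<delta> z = \<delta> x \<and> [z = x + int k * int p] (mod Q)" for k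
  proof (induction k)
    case 0
    then show ?case using assms(3) by auto
  next
    case (Suc k)
    then obtain z where z: "z \<in> S" "\<delta> z = \<delta> x" "[z = x + int k * int p] (mod Q)"
      by blast
    have up: "[z + int p = x + int (Suc k) * int p] (mod Q)"
      using cong_add[OF z(3) cong_refl[of "int p"]] by (simp add: algebra_simps)
    show ?case
    proof (cases "z \<in> A")
      case True
      then show ?thesis
        using A_plus_p_subset_S assms(1) z up by metis
    next
      case False
      with z have zA: "z \<in> S - A" by simp
      have "[z - int n = z + int p] (mod Q)"
        by (simp add: cong_iff_dvd_diff Q_def dvd_def) (rule exI[of _ "-1"], simp)
      then show ?thesis
        using assms(2)[OF zA] S_minus_A_iff[of z] zA z up by (metis DiffD1 cong_trans)
    qed
  qed
  have "coprime (int p) Q"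
    using coprime unfolding Q_def
    by (simp add: coprime_iff_gcd_eq_1 gcd.commute[of p] flip: of_nat_add)
  then obtain l where l: "[int p * l = 1] (mod Q)"
    using cong_solve_coprime_int by blast
  have Q: "Q > 0" using n_pos by (simp add: Q_def)
  \<comment> \<open>With \<open>l\<close> inverse to \<open>p\<close>, this many steps of size
    \<open>p\<close> lead from the class of \<open>x\<close> to that of \<open>y\<close>.\<close>
  define k where "k = nat ((l * (y - x)) mod Q)"
  have "[int k = l * (y - x)] (mod Q)"
    using Q by (simp add: k_def)
  then have "[x + int k * int p = x + l * (y - x) * int p] (mod Q)"
    by (intro cong_add cong_mult) auto
  also have "x + l * (y - x) * int p = x + (int p * l) * (y - x)"
    by (simp add: algebra_simps)
  also have "[x + (int p * l) * (y - x) = x + 1 * (y - x)] (mod Q)"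
    using l by (intro cong_add cong_mult) auto
  finally have ky: "[x + int k * int p = y] (mod Q)" by simp
  obtain z where z: "z \<in> S" "\<delta> z = \<delta> x" "[z = x + int k * int p] (mod Q)"
    using walk by blast
  then have "z = y"
    using S_cong_eq[OF z(1) assms(4)] cong_trans[OF z(3) ky] by (simp add: Q_def)
  then show ?thesis using z by simp
qed

end

section \<open>Comparison of two permutations with equal tableaux\<close>

theorem theorem2p14:
  fixes n p :: nat and \<omega> \<omega>' :: "int \<Rightarrow> int"
  assumes "n > 0" and "p > 0" and "coprime n p"
    and "\<omega> \<in> affine_symmetric_group n" and "dominant n \<omega>" and "p_stable p \<omega>"
    and "\<omega>' \<in> affine_symmetric_group n" and "dominant n \<omega>'" and "p_stable p \<omega>'"
    and "\<forall>i\<in>{1..int n}. \<forall>j\<in>{1..int n}. i < j \<longrightarrow>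
           rational_shi_tableau n p \<omega> i j = rational_shi_tableau n p \<omega>' i j"
  shows "\<omega> = \<omega>'"
proof -
  interpret D: dominant_stable n p \<omega>
    by unfold_locales (use assms in auto)
  interpret D': dominant_stable n p \<omega>'
    by unfold_locales (use assms in auto)
  obtain h where mono: "strict_mono_on D.S h" and img: "h ` D.S = D'.S"
    using ex_strict_mono_on_finite[OF D.finite_S D'.finite_S] D.card_S D'.card_S by auto
  \<comment> \<open>An order isomorphism preserves ranks, and equal tableaux give equal ranks; this
    pins down \<open>h\<close> on \<open>A\<close> and on \<open>A + p\<close>.\<close>
  have h_eqI: "h x = y" if "x \<in> D.S" "y \<in> D'.S"
    "int (card {z \<in> D.S. z < x}) = int (card {z \<in> D'.S. z < y})" for x y
    using rank_strict_mono[OF mono that(1)] that img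
    by (intro rank_inject[OF D'.finite_S]) auto
  have h_b: "h (D.b i) = D'.b i" if i: "i \<in> {1..int n}" for i
  proof (rule h_eqI)
    show "D.b i \<in> D.S" "D'.b i \<in> D'.S"
      using i D.A_subset_S D'.A_subset_S by (auto simp: D.A_def D'.A_def)
    show "int (card {z \<in> D.S. z < D.b i}) = int (card {z \<in> D'.S. z < D'.b i})"
      unfolding D.rank_b[OF i] D'.rank_b[OF i] using assms(10) i by simp
  qed
  have h_b_plus: "h (D.b i + int p) = D'.b i + int p" if i: "i \<in> {1..int n}" for i
  proof (rule h_eqI)
    show "D.b i + int p \<in> D.S" "D'.b i + int p \<in> D'.S"
      using i D.A_plus_p_subset_S D'.A_plus_p_subset_S by (auto simp: D.A_def D'.A_def)
    show "int (card {z \<in> D.S. z < D.b i + int p}) = int (card {z \<in> D'.S. z < D'.b i + int p})"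
      unfolding D.rank_b_plus_p[OF i] D'.rank_b_plus_p[OF i] using assms(10) i by simp
  qed
  define P where "P = D.S - (\<lambda>a. a + int p) ` D.A"
  define P' where "P' = D'.S - (\<lambda>a. a + int p) ` D'.A"
  have inj: "inj_on h D.S"
    using mono by (rule strict_mono_on_imp_inj_on)
  have h_A: "h ` D.A = D'.A"
    unfolding D.A_def D'.A_def image_image using h_b by (intro image_cong) auto
  have h_A_plus: "h ` (\<lambda>a. a + int p) ` D.A = (\<lambda>a. a + int p) ` D'.A"
    unfolding D.A_def D'.A_def image_image using h_b_plus by (intro image_cong) auto
  have h_compl_A: "h ` (D.S - D.A) = D'.S - D'.A"
    using inj_on_image_set_diff[OF inj _ D.A_subset_S, of D.S] img h_A by auto
  have "(\<lambda>a. a + int p) ` D.A \<subseteq> D.S"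
    using D.A_plus_p_subset_S by auto
  then have h_P: "h ` P = P'"
    unfolding P_def P'_def
    using inj_on_image_set_diff[OF inj, of D.S "(\<lambda>a. a + int p) ` D.A"] img h_A_plus by simp
  have compl_A: "D.S - D.A = (\<lambda>x. x + int n) ` P" "D'.S - D'.A = (\<lambda>x. x + int n) ` P'"
    unfolding P_def P'_def
    using D.S_minus_A_iff D'.S_minus_A_iff by (force intro: rev_image_eqI)+
  text \<open>Both sides are order isomorphisms from \<open>P\<close> onto \<open>P' + n\<close>, and there is only one.\<close>
  have h_minus: "h (x + int n) = h x + int n" if "x \<in> P" for x
  proof (rule strict_mono_on_eqI[OF _ _ _ _ that])
    show "finite P" using D.finite_S by (simp add: P_def)
    have "x + int n \<in> D.S" if "x \<in> P" for x
      using compl_A(1) that by blast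
    then show "strict_mono_on P (\<lambda>x. h (x + int n))"
      using mono by (auto simp: strict_mono_on_def)
    show "strict_mono_on P (\<lambda>x. h x + int n)"
      using mono by (auto simp: strict_mono_on_def P_def)
    have "(\<lambda>x. h (x + int n)) ` P = h ` (D.S - D.A)"
      unfolding compl_A by (simp add: image_image)
    also have "\<dots> = (\<lambda>x. x + int n) ` h ` P"
      unfolding h_compl_A h_P by (rule compl_A(2))
    finally show "(\<lambda>x. h (x + int n)) ` P = (\<lambda>x. h x + int n) ` P"
      by (simp add: image_image)
  qed
  define c where "c = D'.b 1 - D.b 1"
  have b_shift: "D'.b i = D.b i + c" if i: "i \<in> {1..int n}" for i
  proof -
    have one: "1 \<in> {1..int n}" using assms(1) by simp
    \<comment> \<open>The displacement of \<open>h\<close> is constant on \<open>S\<close>, because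
      \<open>h\<close> commutes with adding \<open>p\<close> on \<open>A\<close> and with
      subtracting \<open>n\<close> on \<open>S - A\<close>.\<close>
    have "h (D.b i) - D.b i = h (D.b 1) - D.b 1"
    proof (rule D.S_invariant_constant[where \<delta> = "\<lambda>x. h x - x"])
      show "h (x + int p) - (x + int p) = h x - x" if "x \<in> D.A" for x
        using that h_b h_b_plus by (auto simp: D.A_def)
      show "h (x - int n) - (x - int n) = h x - x" if "x \<in> D.S - D.A" for x
        using that h_minus unfolding compl_A(1) by auto
      show "D.b i \<in> D.S" "D.b 1 \<in> D.S"
        using i one D.A_subset_S by (auto simp: D.A_def)
    qed
    then show ?thesis
      using h_b[OF i] h_b[OF one] by (simp add: c_def)
  qed
  \<comment> \<open>Every integer is some \<open>b j + k n\<close> with \<open>j\<close> in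
    \<open>{1..n}\<close>, so periodicity extends the translation from \<open>A\<close> to all
    integers.\<close>
  have shift: "\<omega>' (x + c) = \<omega> x" for x
  proof -
    define j where "j = (\<omega> x - 1) mod int n + 1"
    define k where "k = (\<omega> x - 1) div int n"
    have j: "j \<in> {1..int n}"
      using assms(1) by (simp add: j_def add1_zle_eq)
    have wx: "\<omega> x = j + k * int n"
      by (simp add: j_def k_def)
    then have "x = D.b j + k * int n"
      using D.w_b_plus[of j k] D.w_inject by metis
    then have "x + c = D'.b j + k * int n"
      using b_shift[OF j] by simp
    then show ?thesis
      using D'.w_b_plus[of j k] wx by simp
  qed
  \<comment> \<open>Shifting the window by \<open>c\<close> changes the sum by \<open>n c\<close>,
    yet both normalised sums are equal.\<close>
  have "(\<Sum>i = 1..int n. \<omega>' i) + int n * c = (\<Sum>i = 1..int n. \<omega> i)"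
    using sum_affine_window[of \<omega>' n c] D'.periodic shift by simp
  then have "c = 0"
    using D.sum_window D'.sum_window assms(1) by simp
  then show ?thesis
    using shift by auto
qed

end
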